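(* Let $\mathcal S$ be a generalized KM-arc of type $(0,m,t)$ in a projective plane $\Pi_q$ of order $q$. If $m$ does not divide $q-t$, then either $\mathcal S$ is a maximal arc with one point removed, or there are more than $q+1$ $t$-secants of $\mathcal S$ (and hence the $t$-secants are not concurrent).
   Context: A generalized KM-arc of type $(0,m,t)$ in a projective plane of order $q$ is a proper non-empty subset $\mathcal S$ of the points with $|\mathcal S|=q(m-1)+t$ such that every line meets $\mathcal S$ in $0$, $m$ or $t$ points. A $t$-secant is a line meeting $\mathcal S$ in exactly $t$ points. A maximal arc is a non-empty proper point set such that every line meets it in $0$ or in $d$ points for some fixed $d$. *)

theory Defs
  imports Main
begin

text \<open>Lines are identified with the sets of points incident with them.\<close>

locale projective_plane =
  fixes points :: "'p set" and lines :: "'p set set"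
  assumes line_subset: "l \<in> lines \<Longrightarrow> l \<subseteq> points"
    and join: "\<lbrakk>A \<in> points; B \<in> points; A \<noteq> B\<rbrakk> \<Longrightarrow> \<exists>!l. l \<in> lines \<and> A \<in> l \<and> B \<in> l"
    and meet: "\<lbrakk>l \<in> lines; k \<in> lines; l \<noteq> k\<rbrakk> \<Longrightarrow> \<exists>!P. P \<in> points \<and> P \<in> l \<and> P \<in> k"
    and quadrangle: "\<exists>Q\<subseteq>points. card Q = 4 \<and> (\<forall>l\<in>lines. card (l \<inter> Q) \<le> 2)"

locale projective_plane_of_order = projective_plane points lines
  for points :: "'p set" and lines :: "'p set set" +
  fixes q :: nat
  assumes card_line: "l \<in> lines \<Longrightarrow> card l = q + 1"

definition secants :: "'p set set \<Rightarrow> nat \<Rightarrow> 'p set \<Rightarrow> 'p set set" where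
  "secants lines k S = {l \<in> lines. card (l \<inter> S) = k}"

definition concurrent :: "'p set \<Rightarrow> 'p set set \<Rightarrow> bool" where
  "concurrent points K \<longleftrightarrow> (\<exists>P\<in>points. \<forall>l\<in>K. P \<in> l)"

text \<open>The size condition is stated over the integers, so that \<open>m - 1\<close> is not truncated for \<open>m = 0\<close>.\<close>

definition generalized_KM_arc ::
  "'p set \<Rightarrow> 'p set set \<Rightarrow> nat \<Rightarrow> nat \<Rightarrow> nat \<Rightarrow> 'p set \<Rightarrow> bool" where
  "generalized_KM_arc points lines q m t S \<longleftrightarrow>
     S \<noteq> {} \<and> S \<subset> points \<and>
     int (card S) = int q * (int m - 1) + int t \<and>
     (\<forall>l\<in>lines. card (l \<inter> S) \<in> {0, m, t})"

definition maximal_arc :: "'p set \<Rightarrow> 'p set set \<Rightarrow> 'p set \<Rightarrow> bool" where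
  "maximal_arc points lines M \<longleftrightarrow>
     M \<noteq> {} \<and> M \<subset> points \<and> (\<exists>d. \<forall>l\<in>lines. card (l \<inter> M) \<in> {0, d})"

end

theory Submission
  imports Defs
begin

text \<open>
  Counting \<open>\<S>\<close> along the pencil of one of its points shows that (for \<open>m \<noteq> t\<close>) each point of \<open>\<S>\<close> is on
  exactly one \<open>t\<close>-secant, while a point outside \<open>\<S>\<close> on no \<open>t\<close>-secant would give \<open>m dvd card \<S>\<close>, that is
  \<open>m dvd q - t\<close>. So the \<open>t\<close>-secants cover the plane, and they cut every further line \<open>k\<close> in all of its
  \<open>q + 1\<close> points; hence there are at least \<open>q + 1\<close> of them. In case of equality they cut \<open>k\<close> in
  distinct points, so the common point of two \<open>t\<close>-secants lies on \<open>t\<close>-secants only and they form a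
  pencil. Then \<open>t (q + 1) = card \<S>\<close> gives \<open>t = m - 1\<close>, and adding the vertex of the pencil to \<open>\<S>\<close>
  yields a maximal arc of degree \<open>m\<close>.
\<close>

section \<open>Incidence in a projective plane\<close>

context projective_plane
begin

definition pencil :: "'p \<Rightarrow> 'p set set" where
  "pencil P = {l \<in> lines. P \<in> l}"

lemma line_eqI:
  assumes "l \<in> lines" "k \<in> lines" "A \<in> l" "B \<in> l" "A \<in> k" "B \<in> k" "A \<noteq> B"
  shows "l = k"
  using assms join[of A B] line_subset by blast

lemma ex_triangle:
  obtains A B C where "A \<in> points" "B \<in> points" "C \<in> points"
    "A \<noteq> B" "B \<noteq> C" "A \<noteq> C" "\<forall>l\<in>lines. \<not> (A \<in> l \<and> B \<in> l \<and> C \<in> l)"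
proof -
  obtain Q where Q: "Q \<subseteq> points" "card Q = 4" "\<forall>l\<in>lines. card (l \<inter> Q) \<le> 2"
    using quadrangle by blast
  have fin: "finite Q"
    using Q(2) by (auto intro: card_ge_0_finite)
  obtain T where T: "T \<subseteq> Q" "card T = 3"
    using obtain_subset_with_card_n[of 3 Q] Q(2) by auto
  obtain A B C where ABC: "T = {A, B, C}" "A \<noteq> B" "B \<noteq> C" "A \<noteq> C"
    using T(2) by (auto simp: card_3_iff)
  have "\<not> (A \<in> l \<and> B \<in> l \<and> C \<in> l)" if "l \<in> lines" for l
  proof
    assume "A \<in> l \<and> B \<in> l \<and> C \<in> l"
    then have "T \<subseteq> l \<inter> Q"
      using ABC(1) T(1) by auto
    then have "card T \<le> card (l \<inter> Q)"
      using fin by (intro card_mono) auto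
    then show False
      using Q(3) that T(2) by fastforce
  qed
  then show thesis
    using that[of A B C] ABC T(1) Q(1) by blast
qed

text \<open>The three sides of a triangle have no common point, since two of them meet only in a
  vertex.\<close>

lemma ex_line_avoiding:
  obtains l where "l \<in> lines" "P \<notin> l"
proof -
  obtain A B C where ABC: "A \<in> points" "B \<in> points" "C \<in> points"
    "A \<noteq> B" "B \<noteq> C" "A \<noteq> C" "\<forall>l\<in>lines. \<not> (A \<in> l \<and> B \<in> l \<and> C \<in> l)"
    by (rule ex_triangle)
  obtain x where x: "x \<in> lines" "A \<in> x" "B \<in> x" using join ABC by blast
  obtain y where y: "y \<in> lines" "B \<in> y" "C \<in> y" using join ABC by blast
  obtain z where z: "z \<in> lines" "A \<in> z" "C \<in> z" using join ABC by blast
  show thesis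
  proof (rule ccontr)
    assume "\<not> thesis"
    then have "P \<in> x" "P \<in> y" "P \<in> z"
      using that x y z by blast+
    then have "P = B" "P = C"
      using line_eqI[of x y P B] line_eqI[of y z P C] ABC(7) x y z by blast+
    then show False
      using ABC by blast
  qed
qed

lemma disjoint_pencil:
  assumes "l \<in> pencil P" "k \<in> pencil P" "l \<noteq> k"
  shows "(l \<inter> T - {P}) \<inter> (k \<inter> T - {P}) = {}"
  using assms line_eqI[of l k P] unfolding pencil_def by blast

end

section \<open>Counting in a plane of order \<open>q\<close>\<close>

context projective_plane_of_order
begin

text \<open>\<open>card\<close> is 0 on infinite sets, so the positive value \<open>q + 1\<close>
  forces finiteness.\<close>

lemma finite_line: "l \<in> lines \<Longrightarrow> finite l"
  using card_line by (intro card_ge_0_finite) simp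

text \<open>Projection from \<open>P\<close> is a bijection from the points of a line
  \<open>l\<close> missing \<open>P\<close> onto the lines through \<open>P\<close>;
  \<open>f\<close> is this projection.\<close>

lemma card_pencil:
  assumes P: "P \<in> points"
  shows "card (pencil P) = q + 1"
proof -
  obtain l where l: "l \<in> lines" "P \<notin> l"
    by (rule ex_line_avoiding)
  define f where "f A = (THE k. k \<in> lines \<and> P \<in> k \<and> A \<in> k)" for A
  have f: "f A \<in> lines" "P \<in> f A" "A \<in> f A" if "A \<in> l" for A
  proof -
    have "\<exists>!k. k \<in> lines \<and> P \<in> k \<and> A \<in> k"
      using that l line_subset P join[of P A] by blast
    from theI'[OF this] show "f A \<in> lines" "P \<in> f A" "A \<in> f A"
      unfolding f_def by auto
  qed
  have "inj_on f l"
  proof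
    fix A B assume "A \<in> l" "B \<in> l" "f A = f B"
    then show "A = B"
      using f[of A] f[of B] l line_eqI[of l "f A" A B] by auto
  qed
  moreover have "f ` l = pencil P"
  proof
    show "f ` l \<subseteq> pencil P"
      using f by (auto simp: pencil_def)
    show "pencil P \<subseteq> f ` l"
    proof
      fix k assume "k \<in> pencil P"
      then have k: "k \<in> lines" "P \<in> k"
        by (auto simp: pencil_def)
      then obtain A where A: "A \<in> l" "A \<in> k"
        using meet[of l k] l by blast
      then have "k = f A"
        using f[of A] k l line_eqI[of k "f A" P A] by blast
      then show "k \<in> f ` l"
        using A by blast
    qed
  qed
  ultimately show ?thesis
    using card_image card_line l(1) by metis
qed

lemma finite_pencil: "P \<in> points \<Longrightarrow> finite (pencil P)"
  using card_pencil by (intro card_ge_0_finite) simp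

text \<open>A line joining two points has at least two points. This later allows cancelling
  \<open>q\<close> and separates \<open>q + 1\<close> from 1.\<close>

lemma order_pos: "q > 0"
proof -
  obtain A B C where ABC: "A \<in> points" "B \<in> points" "C \<in> points"
    "A \<noteq> B" "B \<noteq> C" "A \<noteq> C" "\<forall>l\<in>lines. \<not> (A \<in> l \<and> B \<in> l \<and> C \<in> l)"
    by (rule ex_triangle)
  obtain x where x: "x \<in> lines" "A \<in> x" "B \<in> x" using join ABC by blast
  have "card {A, B} \<le> card x"
    using x finite_line by (intro card_mono) auto
  then show ?thesis
    using card_line x ABC by simp
qed

lemma Union_pencil:
  assumes P: "P \<in> points"
  shows "\<Union>(pencil P) = points"
proof
  show "\<Union>(pencil P) \<subseteq> points"
    using line_subset by (auto simp: pencil_def)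
  \<comment> \<open>This covers \<open>P\<close> itself; every other point is covered by its join
    with \<open>P\<close>.\<close>
  have "pencil P \<noteq> {}"
    using card_pencil[OF P] by force
  moreover have "A \<in> \<Union>(pencil P)" if "A \<in> points" "A \<noteq> P" for A
    using join[of A P] that P unfolding pencil_def by blast
  ultimately show "points \<subseteq> \<Union>(pencil P)"
    unfolding pencil_def by blast
qed

lemma finite_points: "finite points"
proof -
  obtain A where A: "A \<in> points"
    using ex_triangle by blast
  have "finite (\<Union>(pencil A))"
    using finite_pencil[OF A] finite_line by (auto simp: pencil_def)
  then show ?thesis
    using Union_pencil[OF A] by simp
qed

lemma finite_lines: "finite lines"
  using finite_points line_subset by (intro finite_subset[of lines "Pow points"]) auto

text \<open>The lines through \<open>P\<close> partition the points other than \<open>P\<close>.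
  Deleting \<open>P\<close> on both sides makes the count valid whether or not \<open>P\<close> lies
  in \<open>T\<close>.\<close>

lemma card_eq_sum_pencil:
  assumes "P \<in> points" "T \<subseteq> points"
  shows "card (T - {P}) = (\<Sum>l\<in>pencil P. card (l \<inter> T - {P}))"
proof -
  have "T - {P} = (\<Union>l\<in>pencil P. l \<inter> T - {P})"
    using Union_pencil[OF assms(1)] assms(2) by blast
  moreover have "card (\<Union>l\<in>pencil P. l \<inter> T - {P}) = (\<Sum>l\<in>pencil P. card (l \<inter> T - {P}))"
    using finite_pencil[OF assms(1)] finite_line disjoint_pencil
    by (intro card_UN_disjoint) (auto simp: pencil_def)
  ultimately show ?thesis
    by simp
qed

section \<open>Sets of lines covering the plane\<close>

text \<open>As \<open>k\<close> is not in \<open>K\<close>, each member of \<open>K\<close> meets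
  \<open>k\<close> in exactly one point; sending it there is a map onto \<open>k\<close> because
  \<open>K\<close> covers the plane.\<close>

lemma image_meet_covering:
  assumes "K \<subseteq> lines" "points \<subseteq> \<Union>K" "k \<in> lines" "k \<notin> K"
  shows "k = (\<lambda>l. THE P. P \<in> l \<inter> k) ` K" and "\<And>l. l \<in> K \<Longrightarrow> (THE P. P \<in> l \<inter> k) \<in> l \<inter> k"
    and "\<And>l P. l \<in> K \<Longrightarrow> P \<in> l \<inter> k \<Longrightarrow> (THE P. P \<in> l \<inter> k) = P"
proof -
  have ex1: "\<exists>!P. P \<in> l \<inter> k" if "l \<in> K" for l
    using meet[of l k] that assms line_subset by blast
  show mem: "(THE P. P \<in> l \<inter> k) \<in> l \<inter> k" if "l \<in> K" for l
    using theI'[OF ex1[OF that]] .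
  show eq: "(THE P. P \<in> l \<inter> k) = P" if "l \<in> K" "P \<in> l \<inter> k" for l P
    using ex1[OF that(1)] mem[OF that(1)] that(2) by blast
  show "k = (\<lambda>l. THE P. P \<in> l \<inter> k) ` K"
  proof
    show "(\<lambda>l. THE P. P \<in> l \<inter> k) ` K \<subseteq> k"
      using mem by blast
    show "k \<subseteq> (\<lambda>l. THE P. P \<in> l \<inter> k) ` K"
    proof
      fix P assume P: "P \<in> k"
      then obtain l where "l \<in> K" "P \<in> l"
        using assms line_subset by blast
      then show "P \<in> (\<lambda>l. THE P. P \<in> l \<inter> k) ` K"
        using eq[of l P] P by force
    qed
  qed
qed

lemma covering_card_ge:
  assumes "K \<subseteq> lines" "points \<subseteq> \<Union>K" "k \<in> lines" "k \<notin> K"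
  shows "card K \<ge> q + 1"
proof -
  have "card k \<le> card K"
    by (subst image_meet_covering(1)[OF assms], rule card_image_le)
      (use assms finite_lines finite_subset in blast)
  then show ?thesis
    using card_line assms by simp
qed

text \<open>Take for \<open>P\<close> the common point of two members. If a line \<open>k\<close>
  through \<open>P\<close> were outside \<open>K\<close>, the map of \<open>q + 1\<close> lines onto
  the \<open>q + 1\<close> points of \<open>k\<close> would be injective, yet both members go to
  \<open>P\<close>. So the pencil lies in \<open>K\<close>, and sizes agree.\<close>

lemma covering_eq_pencil:
  assumes K: "K \<subseteq> lines" "points \<subseteq> \<Union>K" "card K = q + 1"
  obtains P where "P \<in> points" "K = pencil P"
proof -
  have fin: "finite K"
    using K finite_lines finite_subset by blast
  have "card K \<noteq> 0" "card K \<noteq> 1"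
    using K order_pos by auto
  then obtain x y where xy: "x \<in> K" "y \<in> K" "x \<noteq> y"
    by (metis card_1_singletonE card_eq_0_iff is_singletonI' is_singleton_altdef all_not_in_conv fin)
  then obtain P where P: "P \<in> points" "P \<in> x" "P \<in> y"
    using meet[of x y] K(1) by blast
  have "pencil P \<subseteq> K"
  proof
    fix k assume "k \<in> pencil P"
    then have k: "k \<in> lines" "P \<in> k"
      by (auto simp: pencil_def)
    show "k \<in> K"
    proof (rule ccontr)
      assume nk: "k \<notin> K"
      note im = image_meet_covering[OF K(1,2) k(1) nk]
      have "card ((\<lambda>l. THE P. P \<in> l \<inter> k) ` K) = card K"
        using im(1) card_line[OF k(1)] K(3) by simp
      then have "inj_on (\<lambda>l. THE P. P \<in> l \<inter> k) K"
        using fin by (rule eq_card_imp_inj_on[rotated])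
      then show False
        using xy im(3)[of x P] im(3)[of y P] P k by (auto dest: inj_onD)
    qed
  qed
  then have "pencil P = K"
    using fin K(3) card_pencil[OF P(1)] by (intro card_subset_eq) auto
  then show thesis
    using that P by blast
qed

section \<open>The \<open>t\<close>-secants of a generalized KM-arc\<close>

lemma KM_arc_unique_secant:
  assumes S: "generalized_KM_arc points lines q m t S" and "m \<noteq> t" and A: "A \<in> S"
  shows "card (pencil A \<inter> secants lines t S) = 1"
proof -
  have Sp: "S \<subseteq> points" and cS: "int (card S) = int q * (int m - 1) + int t"
    and sec: "\<And>l. l \<in> lines \<Longrightarrow> card (l \<inter> S) \<in> {0, m, t}"
    using S by (auto simp: generalized_KM_arc_def)
  have Ap: "A \<in> points" and fS: "finite S"
    using A Sp finite_points finite_subset by auto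
  \<comment> \<open>The size 0 cannot occur, as \<open>A\<close> is on \<open>l\<close> and in
    \<open>S\<close>; on a \<open>t\<close>-secant, \<open>t - 1\<close> is written as
    \<open>(m - 1) + (t - m)\<close>.\<close>
  have line: "int (card (l \<inter> S - {A})) = int m - 1 + (if l \<in> secants lines t S then int t - int m else 0)"
    if "l \<in> pencil A" for l
  proof -
    have l: "l \<in> lines" "A \<in> l \<inter> S"
      using that A by (auto simp: pencil_def)
    then have "card (l \<inter> S) > 0"
      using fS by (auto simp: card_gt_0_iff)
    then have "int (card (l \<inter> S - {A})) = int (card (l \<inter> S)) - 1"
      using l by (simp add: card_Diff_singleton)
    then show ?thesis
      using sec[OF l(1)] l(1) \<open>card (l \<inter> S) > 0\<close> by (auto simp: secants_def)
  qed
  have "int (card S) - 1 = int (card (S - {A}))"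
    using A fS card_gt_0_iff[of S] by (auto simp: card_Diff_singleton)
  also have "\<dots> = (\<Sum>l\<in>pencil A. int (card (l \<inter> S - {A})))"
    using card_eq_sum_pencil[OF Ap Sp] by simp
  also have "\<dots> = (\<Sum>l\<in>pencil A. int m - 1 + (if l \<in> secants lines t S then int t - int m else 0))"
    using line by (rule sum.cong[OF refl])
  also have "\<dots> = (int q + 1) * (int m - 1) + int (card (pencil A \<inter> secants lines t S)) * (int t - int m)"
    using finite_pencil[OF Ap] card_pencil[OF Ap]
    by (simp add: sum.distrib sum.inter_restrict[symmetric])
  finally have "(int (card (pencil A \<inter> secants lines t S)) - 1) * (int t - int m) = 0"
    using cS by (simp add: algebra_simps)
  then show ?thesis
    using \<open>m \<noteq> t\<close> by auto
qed

text \<open>Otherwise the pencil count makes \<open>m\<close> divide \<open>card S\<close>, hence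
  also \<open>q * m - card S = q - t\<close>. The conclusion excludes both 0 and \<open>m\<close>
  instead of naming \<open>t\<close>, so that it also yields \<open>m \<noteq> t\<close>.\<close>

lemma KM_arc_secant_through_outer_point:
  assumes S: "generalized_KM_arc points lines q m t S" and nd: "\<not> int m dvd int q - int t"
    and P: "P \<in> points" "P \<notin> S"
  shows "\<exists>l\<in>pencil P. card (l \<inter> S) \<noteq> 0 \<and> card (l \<inter> S) \<noteq> m"
proof (rule ccontr)
  assume no: "\<not> ?thesis"
  have Sp: "S \<subseteq> points" and cS: "int (card S) = int q * (int m - 1) + int t"
    using S by (auto simp: generalized_KM_arc_def)
  have "card S = (\<Sum>l\<in>pencil P. card (l \<inter> S))"
    using card_eq_sum_pencil[OF P(1) Sp] P(2) by simp
  moreover have "m dvd (\<Sum>l\<in>pencil P. card (l \<inter> S))"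
    using no by (intro dvd_sum) auto
  ultimately have "int m dvd int (card S)"
    by (metis of_nat_dvd_iff)
  then have "int m dvd int q * int m - int (card S)"
    by simp
  moreover have "int q * int m - int (card S) = int q - int t"
    using cS by (simp add: algebra_simps)
  ultimately show False
    using nd by simp
qed

lemma KM_arc_degrees_differ:
  assumes S: "generalized_KM_arc points lines q m t S" and nd: "\<not> int m dvd int q - int t"
  shows "m \<noteq> t"
proof -
  obtain P where P: "P \<in> points" "P \<notin> S"
    using S by (auto simp: generalized_KM_arc_def)
  obtain l where "l \<in> lines" "card (l \<inter> S) \<noteq> 0" "card (l \<inter> S) \<noteq> m"
    using KM_arc_secant_through_outer_point[OF S nd P] by (auto simp: pencil_def)
  then show ?thesis
    using S by (auto simp: generalized_KM_arc_def)
qed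

lemma KM_arc_secants_cover:
  assumes S: "generalized_KM_arc points lines q m t S" and nd: "\<not> int m dvd int q - int t"
  shows "points \<subseteq> \<Union>(secants lines t S)"
proof
  fix P assume P: "P \<in> points"
  show "P \<in> \<Union>(secants lines t S)"
  proof (cases "P \<in> S")
    case True
    then have "pencil P \<inter> secants lines t S \<noteq> {}"
      using KM_arc_unique_secant[OF S KM_arc_degrees_differ[OF S nd] True] by force
    then show ?thesis
      by (auto simp: pencil_def)
  next
    case False
    obtain l where "l \<in> lines" "P \<in> l" "card (l \<inter> S) \<noteq> 0" "card (l \<inter> S) \<noteq> m"
      using KM_arc_secant_through_outer_point[OF S nd P False] by (auto simp: pencil_def)
    then show ?thesis
      using S by (auto simp: generalized_KM_arc_def secants_def)
  qed
qed

text \<open>The \<open>t\<close>-secants partition \<open>S\<close>: they cover it, and two of them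
  cannot share a point of \<open>S\<close> by uniqueness.\<close>

lemma KM_arc_card_eq_secants:
  assumes S: "generalized_KM_arc points lines q m t S" and nd: "\<not> int m dvd int q - int t"
  shows "card S = card (secants lines t S) * t"
proof -
  have Sp: "S \<subseteq> points"
    using S by (auto simp: generalized_KM_arc_def)
  have "S = (\<Union>l\<in>secants lines t S. l \<inter> S)"
    using KM_arc_secants_cover[OF S nd] Sp by blast
  moreover have "card (\<Union>l\<in>secants lines t S. l \<inter> S) = (\<Sum>l\<in>secants lines t S. card (l \<inter> S))"
  proof (rule card_UN_disjoint)
    show "finite (secants lines t S)"
      using finite_lines by (simp add: secants_def)
    show "\<forall>l\<in>secants lines t S. finite (l \<inter> S)"
      using finite_line by (auto simp: secants_def)
    show "\<forall>l\<in>secants lines t S. \<forall>k\<in>secants lines t S. l \<noteq> k \<longrightarrow> (l \<inter> S) \<inter> (k \<inter> S) = {}"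
    proof (intro ballI impI, rule ccontr)
      fix l k assume lk: "l \<in> secants lines t S" "k \<in> secants lines t S" "l \<noteq> k"
        and "(l \<inter> S) \<inter> (k \<inter> S) \<noteq> {}"
      then obtain A where A: "A \<in> S" "A \<in> l" "A \<in> k"
        by blast
      then have "l \<in> pencil A \<inter> secants lines t S" "k \<in> pencil A \<inter> secants lines t S"
        using lk by (auto simp: pencil_def secants_def)
      then show False
        using KM_arc_unique_secant[OF S KM_arc_degrees_differ[OF S nd] A(1)] lk(3)
        by (metis card_1_singletonE singletonD)
    qed
  qed
  ultimately show ?thesis
    by (simp add: secants_def)
qed

lemma KM_arc_card_secants_ge:
  assumes S: "generalized_KM_arc points lines q m t S" and nd: "\<not> int m dvd int q - int t"
  shows "card (secants lines t S) \<ge> q + 1"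
proof -
  obtain A where A: "A \<in> S" "A \<in> points"
    using S by (auto simp: generalized_KM_arc_def)
  \<comment> \<open>Only one of the \<open>q + 1 > 1\<close> lines through \<open>A\<close> is a
    \<open>t\<close>-secant; any other serves as the line outside the covering set.\<close>
  have "pencil A \<inter> secants lines t S \<noteq> pencil A"
    using KM_arc_unique_secant[OF S KM_arc_degrees_differ[OF S nd] A(1)] card_pencil[OF A(2)] order_pos
    by auto
  then obtain k where "k \<in> lines" "k \<notin> secants lines t S"
    by (auto simp: pencil_def)
  then show ?thesis
    using covering_card_ge[OF _ KM_arc_secants_cover[OF S nd]] by (auto simp: secants_def)
qed

lemma maximal_arc_of_concurrent_secants:
  assumes S: "generalized_KM_arc points lines q m t S" and nd: "\<not> int m dvd int q - int t"
    and P: "P \<in> points" "secants lines t S = pencil P"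
  shows "P \<notin> S \<and> maximal_arc points lines (insert P S)"
proof
  have Sp: "S \<subseteq> points" and cS: "int (card S) = int q * (int m - 1) + int t"
    and sec: "\<And>l. l \<in> lines \<Longrightarrow> card (l \<inter> S) \<in> {0, m, t}"
    using S by (auto simp: generalized_KM_arc_def)
  \<comment> \<open>A point of \<open>S\<close> is on a single \<open>t\<close>-secant, whereas
    \<open>P\<close> is on \<open>q + 1 > 1\<close> of them.\<close>
  show nP: "P \<notin> S"
    using KM_arc_unique_secant[OF S KM_arc_degrees_differ[OF S nd], of P] P(2) card_pencil[OF P(1)] order_pos
    by auto
  have "int (card S) = (int q + 1) * int t"
    using KM_arc_card_eq_secants[OF S nd] P card_pencil[OF P(1)] by (simp add: algebra_simps)
  then have "int q * (int m - 1 - int t) = 0"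
    using cS by (simp add: algebra_simps)
  then have m: "m = t + 1"
    using order_pos by auto
  have through: "card (l \<inter> insert P S) = m" if "l \<in> pencil P" for l
  proof -
    have l: "l \<in> lines" "P \<in> l" "card (l \<inter> S) = t"
      using that P(2) by (auto simp: pencil_def secants_def)
    then have "l \<inter> insert P S = insert P (l \<inter> S)" "finite (l \<inter> S)"
      using finite_line by auto
    then show ?thesis
      using nP l m by simp
  qed
  have "card (l \<inter> insert P S) \<in> {0, m}" if "l \<in> lines" for l
  proof (cases "P \<in> l")
    case True
    then show ?thesis
      using through that by (simp add: pencil_def)
  next
    case False
    \<comment> \<open>All \<open>t\<close>-secants pass through \<open>P\<close>, so a line missing
      \<open>P\<close> keeps only the sizes 0 and \<open>m\<close>.\<close>
    then have "card (l \<inter> S) \<noteq> t"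
      using that P(2) by (auto simp: pencil_def secants_def)
    then show ?thesis
      using sec[OF that] False by auto
  qed
  \<comment> \<open>If the enlarged set were the whole plane, a line through \<open>P\<close> would
    give \<open>m = q + 1\<close>, so \<open>t = q\<close> and \<open>m\<close> would divide
    \<open>q - t = 0\<close>.\<close>
  moreover have "insert P S \<noteq> points"
  proof
    assume eq: "insert P S = points"
    have "pencil P \<noteq> {}"
      using card_pencil[OF P(1)] by force
    then obtain l where l: "l \<in> pencil P"
      by blast
    then have "l \<inter> insert P S = l" "card l = q + 1"
      using eq line_subset[of l] card_line by (auto simp: pencil_def)
    then show False
      using through[OF l] m nd by simp
  qed
  ultimately show "maximal_arc points lines (insert P S)"
    using Sp P(1) unfolding maximal_arc_def by blast
qed

text \<open>Turns the strict bound on the number of \<open>t\<close>-secants into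
  non-concurrency.\<close>

lemma card_concurrent_le:
  assumes "concurrent points K" "K \<subseteq> lines"
  shows "card K \<le> q + 1"
proof -
  obtain P where P: "P \<in> points" "K \<subseteq> pencil P"
    using assms by (auto simp: concurrent_def pencil_def)
  show ?thesis
    using card_mono[OF finite_pencil[OF P(1)] P(2)] card_pencil[OF P(1)] by simp
qed

end

text \<open>Divisibility is stated over \<open>int\<close>, so that \<open>q - t\<close> is not
  truncated when \<open>t > q\<close>.\<close>

theorem theorem2p13:
  fixes points :: "'p set" and lines :: "'p set set" and q m t :: nat and S :: "'p set"
  assumes "projective_plane_of_order points lines q"
    and "generalized_KM_arc points lines q m t S"
    and "\<not> int m dvd int q - int t"
  shows "(\<exists>M P. maximal_arc points lines M \<and> P \<in> M \<and> S = M - {P}) \<or>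
         (card (secants lines t S) > q + 1 \<and> \<not> concurrent points (secants lines t S))"
proof -
  interpret projective_plane_of_order points lines q
    by fact
  have sub: "secants lines t S \<subseteq> lines"
    by (auto simp: secants_def)
  show ?thesis
  proof (cases "card (secants lines t S) = q + 1")
    case True
    obtain P where P: "P \<in> points" "secants lines t S = pencil P"
      using covering_eq_pencil[OF sub KM_arc_secants_cover[OF assms(2,3)] True] .
    then have "P \<notin> S" "maximal_arc points lines (insert P S)"
      using maximal_arc_of_concurrent_secants[OF assms(2,3) P] by auto
    then show ?thesis
      by (intro disjI1 exI[of _ "insert P S"] exI[of _ P]) auto
  next
    case False
    then have "card (secants lines t S) > q + 1"
      using KM_arc_card_secants_ge[OF assms(2,3)] by simp
    then show ?thesis
      using card_concurrent_le[OF _ sub] by fastforce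
  qed
qed

end
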